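(* Let $(\phi(\tau),\ \tau\in\mathcal{T}_0^p)$ be an admissible family, with value family $V_p$ and strict value family $V_p^+$. Let $S\in\mathcal{T}_0^p$, let $\theta\in\mathcal{T}_S^p$, and let $\alpha$ be a nonnegative bounded $\mathcal{F}_{\theta^-}$-measurable random variable. Then, a.s., $$E[\alpha V_p(\theta)\,|\,\mathcal{F}_{S^-}]=\operatorname*{ess\,sup}_{\tau\in\mathcal{T}_\theta^p}E[\alpha\phi(\tau)\,|\,\mathcal{F}_{S^-}]$$ and $$E[\alpha V_p^+(\theta)\,|\,\mathcal{F}_{S^-}]=\operatorname*{ess\,sup}_{\tau\in\mathcal{T}_{\theta^+}^p}E[\alpha\phi(\tau)\,|\,\mathcal{F}_{S^-}].$$
   Context: Fix $T\in(0,\infty)$ and a filtered probability space $(\Omega,\mathbb{F}=(\mathcal{F}_t)_{t\in[0,T]},P)$ whose filtration satisfies the usual conditions (right-continuity and completeness) and is not quasi-left-continuous; $\mathcal{F}_0$ contains only sets of probability $0$ or $1$. For a stopping time $S$, $\mathcal{F}_{S^-}$ is the usual $\sigma$-field of events strictly before $S$ (with $\mathcal{F}_{0^-}=\mathcal{F}_0$). $\mathcal{T}_0^p$ is the set of predictable stopping times with values in $[0,T]$. For $S\in\mathcal{T}_0^p$, $\mathcal{T}_S^p$ is the set of $\tau\in\mathcal{T}_0^p$ with $\tau\ge S$ a.s., and $\mathcal{T}_{S^+}^p$ is the set of $\tau\in\mathcal{T}_0^p$ with $\tau>S$ a.s. on $\{S<T\}$ and $\tau=T$ a.s. on $\{S=T\}$.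 An admissible family is a family $(\phi(\tau),\ \tau\in\mathcal{T}_0^p)$ such that (1) each $\phi(\tau)$ is an $\mathcal{F}_{\tau^-}$-measurable $[0,\infty]$-valued random variable; (2) for all $\tau,\tau'\in\mathcal{T}_0^p$, $\phi(\tau)=\phi(\tau')$ a.s. on $\{\tau=\tau'\}$. For $S\in\mathcal{T}_0^p$ put $V_p(S):=\operatorname{ess\,sup}_{\tau\in\mathcal{T}_S^p}E[\phi(\tau)|\mathcal{F}_{S^-}]$ and $V_p^+(S):=\operatorname{ess\,sup}_{\tau\in\mathcal{T}_{S^+}^p}E[\phi(\tau)|\mathcal{F}_{S^-}]$. Convention: $0\cdot\infty=0$. *)

theory Defs
  imports "HOL-Probability.Probability"
begin

text \<open>
  The time set \<open>[0,T]\<close> is embedded in the index type \<^typ>\<open>real\<close> of the library's notions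
  \<^const>\<open>stopping_time\<close> and \<^locale>\<open>filtration\<close>. Every filtration indexed by \<open>[0,T]\<close> extends to the
  real line (by \<open>F 0\<close> on the left and \<open>F T\<close> on the right), and for \<open>[0,T]\<close>-valued random times
  the indices outside \<open>[0,T]\<close> impose no condition.
\<close>

text \<open>
  Predictable sigma-field on \<open>[0,T] \<times> \<Omega>\<close>, generated by the sets \<open>{0} \<times> A\<close> with \<open>A \<in> F 0\<close> and
  \<open>(s,t] \<times> A\<close> with \<open>A \<in> F s\<close>.
\<close>

definition predictable_sigma :: "'a measure \<Rightarrow> (real \<Rightarrow> 'a measure) \<Rightarrow> real \<Rightarrow> (real \<times> 'a) measure" where
  "predictable_sigma M F T = sigma ({0..T} \<times> space M)
     ({{0} \<times> A | A. A \<in> sets (F 0)} \<union>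
      {{s<..t} \<times> A | s t A. 0 \<le> s \<and> s < t \<and> t \<le> T \<and> A \<in> sets (F s)})"

text \<open>A stopping time is predictable if its stochastic interval \<open>[[\<tau>, T]]\<close> is a predictable set.\<close>

definition predictable_times :: "'a measure \<Rightarrow> (real \<Rightarrow> 'a measure) \<Rightarrow> real \<Rightarrow> ('a \<Rightarrow> real) set" where
  "predictable_times M F T = {\<tau>. (\<forall>\<omega>\<in>space M. \<tau> \<omega> \<in> {0..T}) \<and> stopping_time F \<tau> \<and>
     {(t, \<omega>). t \<in> {0..T} \<and> \<omega> \<in> space M \<and> \<tau> \<omega> \<le> t} \<in> sets (predictable_sigma M F T)}"

definition predictable_times_from ::
    "'a measure \<Rightarrow> (real \<Rightarrow> 'a measure) \<Rightarrow> real \<Rightarrow> ('a \<Rightarrow> real) \<Rightarrow> ('a \<Rightarrow> real) set" where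
  "predictable_times_from M F T S = {\<tau> \<in> predictable_times M F T. AE \<omega> in M. S \<omega> \<le> \<tau> \<omega>}"

definition predictable_times_after ::
    "'a measure \<Rightarrow> (real \<Rightarrow> 'a measure) \<Rightarrow> real \<Rightarrow> ('a \<Rightarrow> real) \<Rightarrow> ('a \<Rightarrow> real) set" where
  "predictable_times_after M F T S = {\<tau> \<in> predictable_times M F T.
     AE \<omega> in M. (S \<omega> < T \<longrightarrow> S \<omega> < \<tau> \<omega>) \<and> (S \<omega> = T \<longrightarrow> \<tau> \<omega> = T)}"

text \<open>
  Events strictly before \<open>S\<close>: generated by \<open>F 0\<close> and the sets \<open>A \<inter> {t < S}\<close> with \<open>A \<in> F t\<close>.
  For \<open>S = 0\<close> this is \<open>F 0\<close>.
\<close>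

definition strict_past ::
    "'a measure \<Rightarrow> (real \<Rightarrow> 'a measure) \<Rightarrow> real \<Rightarrow> ('a \<Rightarrow> real) \<Rightarrow> 'a measure" where
  "strict_past M F T S = sigma (space M)
     (sets (F 0) \<union> {{\<omega> \<in> A. t < S \<omega>} | t A. t \<in> {0..T} \<and> A \<in> sets (F t)})"

definition quasi_left_continuous :: "'a measure \<Rightarrow> (real \<Rightarrow> 'a measure) \<Rightarrow> real \<Rightarrow> bool" where
  "quasi_left_continuous M F T \<longleftrightarrow>
     (\<forall>\<tau>\<in>predictable_times M F T.
        sets (filtration.pre_sigma (space M) F \<tau>) = sets (strict_past M F T \<tau>))"

locale stochastic_basis =
  prob_space M + complete_measure M + filtration "space M" F
  for M :: "'a measure" and F :: "real \<Rightarrow> 'a measure" +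
  fixes T :: real
  assumes horizon_pos: "0 < T"
    and sets_F_le: "sets (F T) \<subseteq> sets M"
    and null_sets_F0: "null_sets M \<subseteq> sets (F 0)"
    and right_continuous: "\<And>t. 0 \<le> t \<Longrightarrow> t < T \<Longrightarrow> sets (F t) = (\<Inter>s\<in>{t<..T}. sets (F s))"
    and F0_trivial: "\<And>A. A \<in> sets (F 0) \<Longrightarrow> prob A = 0 \<or> prob A = 1"
    and not_quasi_left_continuous: "\<not> quasi_left_continuous M F T"

text \<open>
  Essential supremum of a family of \<open>[0,\<infinity>]\<close>-valued random variables, i.e. a least upper bound with
  respect to the almost sure order. (The library's \<^const>\<open>esssup\<close> is the essential supremum of
  a single function.) It is unique up to a.s. equality, and a version is selected.
\<close>

definition is_ess_sup :: "'a measure \<Rightarrow> 'i set \<Rightarrow> ('i \<Rightarrow> 'a \<Rightarrow> ennreal) \<Rightarrow> ('a \<Rightarrow> ennreal) \<Rightarrow> bool" where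
  "is_ess_sup M I X Y \<longleftrightarrow>
     Y \<in> borel_measurable M \<and> (\<forall>i\<in>I. AE \<omega> in M. X i \<omega> \<le> Y \<omega>) \<and>
     (\<forall>Z\<in>borel_measurable M. (\<forall>i\<in>I. AE \<omega> in M. X i \<omega> \<le> Z \<omega>) \<longrightarrow> (AE \<omega> in M. Y \<omega> \<le> Z \<omega>))"

definition ess_sup_family :: "'a measure \<Rightarrow> 'i set \<Rightarrow> ('i \<Rightarrow> 'a \<Rightarrow> ennreal) \<Rightarrow> 'a \<Rightarrow> ennreal" where
  "ess_sup_family M I X = (SOME Y. is_ess_sup M I X Y)"

definition admissible_family ::
    "'a measure \<Rightarrow> (real \<Rightarrow> 'a measure) \<Rightarrow> real \<Rightarrow> (('a \<Rightarrow> real) \<Rightarrow> 'a \<Rightarrow> ennreal) \<Rightarrow> bool" where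
  "admissible_family M F T \<phi> \<longleftrightarrow>
     (\<forall>\<tau>\<in>predictable_times M F T. \<phi> \<tau> \<in> borel_measurable (strict_past M F T \<tau>)) \<and>
     (\<forall>\<tau>\<in>predictable_times M F T. \<forall>\<tau>'\<in>predictable_times M F T.
        AE \<omega> in M. \<tau> \<omega> = \<tau>' \<omega> \<longrightarrow> \<phi> \<tau> \<omega> = \<phi> \<tau>' \<omega>)"

definition value_family ::
    "'a measure \<Rightarrow> (real \<Rightarrow> 'a measure) \<Rightarrow> real \<Rightarrow> (('a \<Rightarrow> real) \<Rightarrow> 'a \<Rightarrow> ennreal) \<Rightarrow>
     ('a \<Rightarrow> real) \<Rightarrow> 'a \<Rightarrow> ennreal" where
  "value_family M F T \<phi> S = ess_sup_family M (predictable_times_from M F T S)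
     (\<lambda>\<tau>. nn_cond_exp M (strict_past M F T S) (\<phi> \<tau>))"

definition strict_value_family ::
    "'a measure \<Rightarrow> (real \<Rightarrow> 'a measure) \<Rightarrow> real \<Rightarrow> (('a \<Rightarrow> real) \<Rightarrow> 'a \<Rightarrow> ennreal) \<Rightarrow>
     ('a \<Rightarrow> real) \<Rightarrow> 'a \<Rightarrow> ennreal" where
  "strict_value_family M F T \<phi> S = ess_sup_family M (predictable_times_after M F T S)
     (\<lambda>\<tau>. nn_cond_exp M (strict_past M F T S) (\<phi> \<tau>))"

end

theory Submission
  imports Defs
begin

text \<open>
  The theorem interchanges a conditional expectation with an essential supremum. For a
  countable increasing family this is monotone convergence, so the point is to replace the
  uncountable family of predictable times after \<open>\<theta>\<close> by an increasing sequence.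

  Let \<open>H\<close> be the strict past of \<open>\<theta>\<close> and \<open>X \<tau> = E[\<phi> \<tau> | H]\<close>. Given two times \<open>\<sigma>, \<tau>\<close> after \<open>\<theta>\<close>, follow
  \<open>\<sigma>\<close> on the event \<open>A = {X \<tau> \<le> X \<sigma>}\<close> and \<open>\<tau>\<close> off it. As \<open>A\<close> is known strictly before \<open>\<theta>\<close>, the
  resulting time is again predictable (\<open>predictable_times_glue\<close>), and by admissibility
  and locality of conditional expectation its expected reward given \<open>H\<close> is \<open>max (X \<sigma>) (X \<tau>)\<close>. Hence the family \<open>X\<close>
  is directed upwards, and its essential supremum \<open>V\<close> is a.s. the limit of an increasing sequence
  \<open>X (s n)\<close> (\<open>is_ess_sup_directed\<close>).

  Let \<open>G\<close> be the strict past of \<open>S\<close>; it is contained in \<open>H\<close> (\<open>strict_past_mono\<close>). Monotone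
  convergence, the \<open>H\<close>-measurability of \<open>\<alpha>\<close> and the tower property give
  \<open>E[\<alpha> V | G] = sup\<^sub>n E[\<alpha> X (s n) | G] = sup\<^sub>n E[\<alpha> \<phi> (s n) | G]\<close>, which lies below
  every upper bound of the family \<open>E[\<alpha> \<phi> \<tau> | G]\<close>. It is itself an upper bound because \<open>X \<tau> \<le> V\<close> for
  every \<open>\<tau>\<close>. The argument (\<open>nn_cond_exp_ess_sup\<close>) uses only that the family of times is nonempty
  and closed under gluing, so it serves the strict value family as well.
\<close>

section \<open>Essential suprema of directed families\<close>

lemma is_ess_sup_unique:
  assumes "is_ess_sup M I X Y" "is_ess_sup M I X Z"
  shows "AE \<omega> in M. Y \<omega> = Z \<omega>"
proof -
  have "AE \<omega> in M. Y \<omega> \<le> Z \<omega>" "AE \<omega> in M. Z \<omega> \<le> Y \<omega>"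
    using assms unfolding is_ess_sup_def by blast+
  then show ?thesis by eventually_elim simp
qed

lemma is_ess_sup_ess_sup_family:
  "is_ess_sup M I X Y \<Longrightarrow> is_ess_sup M I X (ess_sup_family M I X)"
  unfolding ess_sup_family_def by (rule someI[where P = "is_ess_sup M I X"])

lemma ess_sup_family_eq:
  assumes "is_ess_sup M I X Y"
  shows "AE \<omega> in M. ess_sup_family M I X \<omega> = Y \<omega>"
  using is_ess_sup_unique[OF is_ess_sup_ess_sup_family[OF assms] assms] .

text \<open>
  The map \<open>x \<mapsto> 1 / (1 + x)\<close> is an order-reversing continuous injection of \<open>[0,\<infinity>]\<close> into \<open>[0,1]\<close>. It
  turns arbitrary \<open>[0,\<infinity>]\<close>-valued random variables into integrable ones without losing the order,
  which makes strict inequality visible to the integral.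
\<close>

lemma inverse_one_plus_le_iff:
  fixes x y :: ennreal
  shows "inverse (1 + x) \<le> inverse (1 + y) \<longleftrightarrow> y \<le> x"
proof (cases x; cases y)
  fix r s :: real assume "x = ennreal r" "0 \<le> r" "y = ennreal s" "0 \<le> s"
  then show ?thesis
    by (simp add: ennreal_1[symmetric] ennreal_plus[symmetric] inverse_ennreal del: ennreal_1 ennreal_plus)
qed (auto simp: top_unique)

lemma inverse_one_plus_SUP:
  fixes f :: "nat \<Rightarrow> ennreal"
  shows "inverse (1 + (SUP n. f n)) = (INF n. inverse (1 + f n))"
proof -
  have "continuous_on UNIV (\<lambda>x::ennreal. inverse (1 + x))"
    by (intro continuous_on_inverse_ennreal continuous_on_add_ennreal continuous_intros)
  then have "isCont (\<lambda>x::ennreal. inverse (1 + x)) y" for y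
    by (simp add: continuous_on_eq_continuous_at)
  then have "continuous (at_left (Sup (range f))) (\<lambda>x::ennreal. inverse (1 + x))"
    by (rule continuous_at_imp_continuous_at_within)
  moreover have "antimono (\<lambda>x::ennreal. inverse (1 + x))"
    by (simp add: antimono_def inverse_one_plus_le_iff)
  ultimately show ?thesis
    using continuous_at_Sup_antimono[of "\<lambda>x::ennreal. inverse (1 + x)" "range f"]
    by (simp add: image_comp)
qed

lemma AE_eq_of_nn_integral_le:
  fixes f g :: "'a \<Rightarrow> ennreal"
  assumes [measurable]: "f \<in> borel_measurable M" "g \<in> borel_measurable M"
    and le: "\<And>\<omega>. f \<omega> \<le> g \<omega>"
    and int: "(\<integral>\<^sup>+\<omega>. g \<omega> \<partial>M) \<le> (\<integral>\<^sup>+\<omega>. f \<omega> \<partial>M)" and fin: "(\<integral>\<^sup>+\<omega>. f \<omega> \<partial>M) \<noteq> \<infinity>"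
  shows "AE \<omega> in M. f \<omega> = g \<omega>"
proof -
  have "(\<integral>\<^sup>+\<omega>. g \<omega> - f \<omega> \<partial>M) = (\<integral>\<^sup>+\<omega>. g \<omega> \<partial>M) - (\<integral>\<^sup>+\<omega>. f \<omega> \<partial>M)"
    using le fin by (intro nn_integral_diff) auto
  also have "\<dots> = 0"
    using int fin by (intro diff_eq_0_ennreal) (auto simp: top.not_eq_extremum intro: le_less_trans)
  finally have "AE \<omega> in M. g \<omega> - f \<omega> = 0"
    by (simp add: nn_integral_0_iff_AE)
  then show ?thesis
    by eventually_elim (metis add_diff_inverse_ennreal le add.right_neutral)
qed

text \<open>
  Along a sequence that minimises the integral of \<open>1 / (1 + X i)\<close>, made increasing by directedness,
  the supremum \<open>Y\<close> attains the infimum of these integrals. If some \<open>X i\<close> exceeded \<open>Y\<close> with positive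
  measure, then \<open>max (X i) Y\<close>, again a limit of functions below members of the family, would have a
  strictly smaller integral.
\<close>

lemma (in finite_measure) is_ess_sup_directed:
  fixes X :: "'i \<Rightarrow> 'a \<Rightarrow> ennreal"
  assumes "I \<noteq> {}"
    and meas: "\<And>i. i \<in> I \<Longrightarrow> X i \<in> borel_measurable M"
    and directed: "\<And>i j. i \<in> I \<Longrightarrow> j \<in> I \<Longrightarrow> \<exists>k\<in>I. AE \<omega> in M. X i \<omega> \<le> X k \<omega> \<and> X j \<omega> \<le> X k \<omega>"
  shows "\<exists>s :: nat \<Rightarrow> 'i. (\<forall>n. s n \<in> I) \<and> (\<forall>n. AE \<omega> in M. X (s n) \<omega> \<le> X (s (Suc n)) \<omega>) \<and>
    is_ess_sup M I X (\<lambda>\<omega>. SUP n. X (s n) \<omega>)"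
proof -
  let ?h = "\<lambda>x::ennreal. inverse (1 + x)"
  define J where "J Y = (\<integral>\<^sup>+\<omega>. ?h (Y \<omega>) \<partial>M)" for Y :: "'a \<Rightarrow> ennreal"
  have h_le_1: "?h x \<le> 1" for x
    using inverse_one_plus_le_iff[of x 0] by simp
  have J_fin: "J Y < \<infinity>" for Y
  proof -
    have "J Y \<le> (\<integral>\<^sup>+\<omega>. 1 \<partial>M)"
      unfolding J_def by (intro nn_integral_mono h_le_1)
    also have "\<dots> < \<infinity>" by (simp add: top.not_eq_extremum[symmetric])
    finally show ?thesis .
  qed
  have J_antimono: "J Z \<le> J Y" if "AE \<omega> in M. Y \<omega> \<le> Z \<omega>" for Y Z
    unfolding J_def using that
    by (intro nn_integral_mono_AE) (auto elim!: eventually_mono simp: inverse_one_plus_le_iff)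
  define c where "c = (INF i\<in>I. J (X i))"
  obtain a :: "nat \<Rightarrow> ennreal" where a: "range a \<subseteq> (\<lambda>i. J (X i)) ` I" "c = (INF n. a n)"
    using ennreal_Inf_countable_INF[of "(\<lambda>i. J (X i)) ` I"] \<open>I \<noteq> {}\<close> unfolding c_def by blast
  then have "\<forall>n. \<exists>i\<in>I. a n = J (X i)" by auto
  then obtain j where j: "\<And>n. j n \<in> I" "\<And>n. a n = J (X (j n))" by metis
  \<comment> \<open>An increasing sequence that dominates the minimising sequence \<open>j\<close>.\<close>
  have "\<exists>s. \<forall>n. (s n \<in> I \<and> (AE \<omega> in M. X (j n) \<omega> \<le> X (s n) \<omega>)) \<and>
      ((AE \<omega> in M. X (s n) \<omega> \<le> X (s (Suc n)) \<omega>))"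
  proof (intro dependent_nat_choice)
    show "\<exists>x. x \<in> I \<and> (AE \<omega> in M. X (j 0) \<omega> \<le> X x \<omega>)"
      using j(1)[of 0] by auto
    fix x n assume "x \<in> I \<and> (AE \<omega> in M. X (j n) \<omega> \<le> X x \<omega>)"
    then obtain k where "k \<in> I" "AE \<omega> in M. X (j (Suc n)) \<omega> \<le> X k \<omega> \<and> X x \<omega> \<le> X k \<omega>"
      using directed[of "j (Suc n)" x] j(1)[of "Suc n"] by blast
    then show "\<exists>y. (y \<in> I \<and> (AE \<omega> in M. X (j (Suc n)) \<omega> \<le> X y \<omega>)) \<and> (AE \<omega> in M. X x \<omega> \<le> X y \<omega>)"
      by auto
  qed
  then obtain s where sI: "\<And>n. s n \<in> I" and sj: "\<And>n. AE \<omega> in M. X (j n) \<omega> \<le> X (s n) \<omega>"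
    and s_inc: "\<And>n. AE \<omega> in M. X (s n) \<omega> \<le> X (s (Suc n)) \<omega>"
    by blast
  have [measurable]: "X (s n) \<in> borel_measurable M" for n using meas sI by blast
  let ?Y = "\<lambda>\<omega>. SUP n. X (s n) \<omega>"
  have J_Y: "J ?Y \<le> c"
    unfolding a(2)
  proof (rule INF_greatest)
    fix n
    have "AE \<omega> in M. X (j n) \<omega> \<le> ?Y \<omega>"
      using sj[of n] by eventually_elim (auto intro: SUP_upper2)
    then show "J ?Y \<le> a n" unfolding j(2) by (rule J_antimono)
  qed
  have upper: "AE \<omega> in M. X i \<omega> \<le> ?Y \<omega>" if i: "i \<in> I" for i
  proof -
    note [measurable] = meas[OF i]
    let ?Z = "\<lambda>\<omega>. SUP n. max (X i \<omega>) (X (s n) \<omega>)"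
    have "c \<le> (INF n. J (\<lambda>\<omega>. max (X i \<omega>) (X (s n) \<omega>)))"
    proof (rule INF_greatest)
      fix n
      obtain k where k: "k \<in> I" "AE \<omega> in M. X i \<omega> \<le> X k \<omega> \<and> X (s n) \<omega> \<le> X k \<omega>"
        using directed[OF i sI] by blast
      have "c \<le> J (X k)" unfolding c_def using k(1) by (rule INF_lower)
      also have "J (X k) \<le> J (\<lambda>\<omega>. max (X i \<omega>) (X (s n) \<omega>))"
        by (rule J_antimono) (use k(2) in \<open>eventually_elim, simp\<close>)
      finally show "c \<le> J (\<lambda>\<omega>. max (X i \<omega>) (X (s n) \<omega>))" .
    qed
    also have "\<dots> = J ?Z"
      unfolding J_def inverse_one_plus_SUP
    proof (rule nn_integral_monotone_convergence_INF_AE'[symmetric])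
      show "AE \<omega> in M. ?h (max (X i \<omega>) (X (s (Suc n)) \<omega>)) \<le> ?h (max (X i \<omega>) (X (s n) \<omega>))" for n
        using s_inc[of n]
        by eventually_elim (simp only: inverse_one_plus_le_iff, auto intro: max.coboundedI2)
      show "(\<integral>\<^sup>+\<omega>. ?h (max (X i \<omega>) (X (s 0) \<omega>)) \<partial>M) < \<infinity>"
        using J_fin unfolding J_def .
    qed measurable
    finally have "J ?Y \<le> J ?Z" using J_Y by simp
    have ZY: "?Y \<omega> \<le> ?Z \<omega>" for \<omega>
      by (intro SUP_subset_mono) auto
    have "AE \<omega> in M. ?h (?Z \<omega>) = ?h (?Y \<omega>)"
    proof (rule AE_eq_of_nn_integral_le)
      show "?h (?Z \<omega>) \<le> ?h (?Y \<omega>)" for \<omega> using ZY by (simp only: inverse_one_plus_le_iff)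
      show "(\<integral>\<^sup>+\<omega>. ?h (?Y \<omega>) \<partial>M) \<le> (\<integral>\<^sup>+\<omega>. ?h (?Z \<omega>) \<partial>M)"
        using \<open>J ?Y \<le> J ?Z\<close> unfolding J_def .
      show "(\<integral>\<^sup>+\<omega>. ?h (?Z \<omega>) \<partial>M) \<noteq> \<infinity>"
        using J_fin[of ?Z] unfolding J_def by simp
    qed measurable
    then show ?thesis
    proof eventually_elim
      case (elim \<omega>)
      then have "?Z \<omega> \<le> ?Y \<omega>" by (metis inverse_one_plus_le_iff order_refl)
      moreover have "X i \<omega> \<le> ?Z \<omega>" by (rule SUP_upper2[of 0]) auto
      ultimately show ?case by simp
    qed
  qed
  have least: "AE \<omega> in M. ?Y \<omega> \<le> Z \<omega>" if "\<forall>i\<in>I. AE \<omega> in M. X i \<omega> \<le> Z \<omega>" for Z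
  proof -
    have "AE \<omega> in M. \<forall>n. X (s n) \<omega> \<le> Z \<omega>"
      using that sI by (simp add: AE_all_countable)
    then show ?thesis by eventually_elim (auto intro: SUP_least)
  qed
  have "is_ess_sup M I X ?Y"
    unfolding is_ess_sup_def using upper least by auto
  then show ?thesis using sI s_inc by blast
qed

section \<open>Conditional expectation of an essential supremum\<close>

context sigma_finite_subalgebra
begin

lemma nn_cond_exp_SUP:
  fixes f :: "nat \<Rightarrow> 'a \<Rightarrow> ennreal"
  assumes [measurable]: "\<And>n. f n \<in> borel_measurable M"
    and inc: "\<And>n. AE \<omega> in M. f n \<omega> \<le> f (Suc n) \<omega>"
  shows "AE \<omega> in M. (SUP n. nn_cond_exp M F (f n) \<omega>) = nn_cond_exp M F (\<lambda>\<omega>. SUP n. f n \<omega>) \<omega>"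
proof (rule nn_cond_exp_charact)
  fix A assume A[measurable]: "A \<in> sets F"
  then have [measurable]: "A \<in> sets M" using subalg by (auto simp: subalgebra_def)
  have cinc: "AE \<omega> in M. nn_cond_exp M F (f n) \<omega> \<le> nn_cond_exp M F (f (Suc n)) \<omega>" for n
    by (rule nn_cond_exp_mono[OF inc]) measurable
  have "(\<integral>\<^sup>+\<omega>\<in>A. (SUP n. f n \<omega>) \<partial>M) = (\<integral>\<^sup>+\<omega>. (SUP n. indicator A \<omega> * f n \<omega>) \<partial>M)"
    by (simp add: SUP_mult_left_ennreal mult.commute)
  also have "\<dots> = (SUP n. \<integral>\<^sup>+\<omega>. indicator A \<omega> * f n \<omega> \<partial>M)"
  proof (rule nn_integral_monotone_convergence_SUP_AE)
    show "AE \<omega> in M. indicator A \<omega> * f n \<omega> \<le> indicator A \<omega> * f (Suc n) \<omega>" for n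
      using inc[of n] by eventually_elim (rule mult_left_mono, auto)
  qed measurable
  also have "\<dots> = (SUP n. \<integral>\<^sup>+\<omega>. indicator A \<omega> * nn_cond_exp M F (f n) \<omega> \<partial>M)"
    by (simp add: nn_cond_exp_intg)
  also have "\<dots> = (\<integral>\<^sup>+\<omega>. (SUP n. indicator A \<omega> * nn_cond_exp M F (f n) \<omega>) \<partial>M)"
  proof (rule nn_integral_monotone_convergence_SUP_AE[symmetric])
    show "AE \<omega> in M. indicator A \<omega> * nn_cond_exp M F (f n) \<omega> \<le> indicator A \<omega> * nn_cond_exp M F (f (Suc n)) \<omega>" for n
      using cinc[of n] by eventually_elim (rule mult_left_mono, auto)
  qed measurable
  also have "\<dots> = (\<integral>\<^sup>+\<omega>\<in>A. (SUP n. nn_cond_exp M F (f n) \<omega>) \<partial>M)"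
    by (simp add: SUP_mult_left_ennreal mult.commute)
  finally show "(\<integral>\<^sup>+\<omega>\<in>A. (SUP n. f n \<omega>) \<partial>M) = (\<integral>\<^sup>+\<omega>\<in>A. (SUP n. nn_cond_exp M F (f n) \<omega>) \<partial>M)" .
qed measurable

lemma nn_cond_exp_local:
  assumes A[measurable]: "A \<in> sets F"
    and [measurable]: "f \<in> borel_measurable M" "g \<in> borel_measurable M"
    and eq: "AE \<omega> in M. \<omega> \<in> A \<longrightarrow> f \<omega> = g \<omega>"
  shows "AE \<omega> in M. \<omega> \<in> A \<longrightarrow> nn_cond_exp M F f \<omega> = nn_cond_exp M F g \<omega>"
proof -
  have [measurable]: "A \<in> sets M" using A subalg by (auto simp: subalgebra_def)
  have "AE \<omega> in M. nn_cond_exp M F (\<lambda>\<omega>. indicator A \<omega> * f \<omega>) \<omega> =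
      nn_cond_exp M F (\<lambda>\<omega>. indicator A \<omega> * g \<omega>) \<omega>"
    by (rule nn_cond_exp_cong) (use eq in \<open>auto elim!: eventually_mono simp: indicator_def\<close>)
  moreover have "AE \<omega> in M. indicator A \<omega> * nn_cond_exp M F f \<omega> =
      nn_cond_exp M F (\<lambda>\<omega>. indicator A \<omega> * f \<omega>) \<omega>"
    "AE \<omega> in M. indicator A \<omega> * nn_cond_exp M F g \<omega> =
      nn_cond_exp M F (\<lambda>\<omega>. indicator A \<omega> * g \<omega>) \<omega>"
    by (rule nn_cond_exp_prod; measurable)+
  ultimately show ?thesis by eventually_elim (auto simp: indicator_def split: if_splits)
qed

end

text \<open>
  The abstract form of the theorem. The hypothesis \<open>glue\<close>, used with the event where one conditional
  expectation dominates another, makes the conditional expectations given \<open>H\<close> an upward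
  directed family; it is stated for the variables \<open>f i\<close> because indices agreeing on an event matter
  only through their rewards.
\<close>

lemma (in finite_measure) nn_cond_exp_ess_sup:
  fixes f :: "'i \<Rightarrow> 'a \<Rightarrow> ennreal"
  assumes H: "subalgebra M H" and GH: "subalgebra H G"
    and "I \<noteq> {}"
    and f: "\<And>i. i \<in> I \<Longrightarrow> f i \<in> borel_measurable M"
    and glue: "\<And>i j A. i \<in> I \<Longrightarrow> j \<in> I \<Longrightarrow> A \<in> sets H \<Longrightarrow>
      \<exists>k\<in>I. AE \<omega> in M. (\<omega> \<in> A \<longrightarrow> f k \<omega> = f i \<omega>) \<and> (\<omega> \<notin> A \<longrightarrow> f k \<omega> = f j \<omega>)"
    and a: "a \<in> borel_measurable H"
  shows "AE \<omega> in M.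
      nn_cond_exp M G (\<lambda>\<omega>'. a \<omega>' * ess_sup_family M I (\<lambda>i. nn_cond_exp M H (f i)) \<omega>') \<omega> =
      ess_sup_family M I (\<lambda>i. nn_cond_exp M G (\<lambda>\<omega>'. a \<omega>' * f i \<omega>')) \<omega>"
proof -
  have G: "subalgebra M G" using H GH by (auto simp: subalgebra_def)
  interpret H: finite_measure_subalgebra M H by unfold_locales (rule H)
  interpret G: finite_measure_subalgebra M G by unfold_locales (rule G)
  define X where "X i = nn_cond_exp M H (f i)" for i
  have X[measurable]: "X i \<in> borel_measurable M" "X i \<in> borel_measurable H" for i
    unfolding X_def by measurable
  note [measurable] = a
  have aM[measurable]: "a \<in> borel_measurable M" by (rule measurable_from_subalg[OF H a])
  have "\<exists>k\<in>I. AE \<omega> in M. X i \<omega> \<le> X k \<omega> \<and> X j \<omega> \<le> X k \<omega>" if i: "i \<in> I" and j: "j \<in> I" for i j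
  proof -
    \<comment> \<open>On this event \<open>i\<close> is the better choice, and \<open>H\<close> already decides it.\<close>
    define A where "A = {\<omega>\<in>space H. X j \<omega> \<le> X i \<omega>}"
    have A: "A \<in> sets H" unfolding A_def by measurable
    obtain k where k: "k \<in> I" "AE \<omega> in M. (\<omega> \<in> A \<longrightarrow> f k \<omega> = f i \<omega>) \<and> (\<omega> \<notin> A \<longrightarrow> f k \<omega> = f j \<omega>)"
      using glue[OF i j A] by blast
    have "AE \<omega> in M. \<omega> \<in> A \<longrightarrow> X k \<omega> = X i \<omega>"
      unfolding X_def
      by (rule H.nn_cond_exp_local[OF A f[OF k(1)] f[OF i]]) (use k(2) in eventually_elim, simp)
    moreover have "AE \<omega> in M. \<omega> \<in> space H - A \<longrightarrow> X k \<omega> = X j \<omega>"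
      unfolding X_def
      by (rule H.nn_cond_exp_local[OF sets.compl_sets[OF A] f[OF k(1)] f[OF j]])
        (use k(2) in eventually_elim, simp)
    ultimately have "AE \<omega> in M. X i \<omega> \<le> X k \<omega> \<and> X j \<omega> \<le> X k \<omega>"
      using AE_space
    proof eventually_elim
      case (elim \<omega>)
      moreover have "space H = space M" using H by (simp add: subalgebra_def)
      ultimately show ?case by (cases "\<omega> \<in> A") (auto simp: A_def)
    qed
    then show ?thesis using k(1) by blast
  qed
  then obtain s :: "nat \<Rightarrow> 'i" where s: "\<And>n. s n \<in> I"
    and s_inc: "\<And>n. AE \<omega> in M. X (s n) \<omega> \<le> X (s (Suc n)) \<omega>"
    and s_sup: "is_ess_sup M I X (\<lambda>\<omega>. SUP n. X (s n) \<omega>)"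
    using is_ess_sup_directed[where X = X, OF \<open>I \<noteq> {}\<close> X(1)] by blast
  let ?V = "ess_sup_family M I X"
  have V: "is_ess_sup M I X ?V" by (rule is_ess_sup_ess_sup_family[OF s_sup])
  then have [measurable]: "?V \<in> borel_measurable M" by (simp add: is_ess_sup_def)
  have tower: "AE \<omega> in M. nn_cond_exp M G (\<lambda>\<omega>. a \<omega> * X i \<omega>) \<omega> = nn_cond_exp M G (\<lambda>\<omega>. a \<omega> * f i \<omega>) \<omega>"
    if i: "i \<in> I" for i
  proof -
    note [measurable] = f[OF i]
    have "AE \<omega> in M. nn_cond_exp M G (\<lambda>\<omega>. a \<omega> * f i \<omega>) \<omega> =
        nn_cond_exp M G (nn_cond_exp M H (\<lambda>\<omega>. a \<omega> * f i \<omega>)) \<omega>"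
      by (rule G.nn_cond_exp_nested_subalg[OF H GH]) measurable
    moreover have "AE \<omega> in M. nn_cond_exp M G (\<lambda>\<omega>. a \<omega> * X i \<omega>) \<omega> =
        nn_cond_exp M G (nn_cond_exp M H (\<lambda>\<omega>. a \<omega> * f i \<omega>)) \<omega>"
    proof (rule G.nn_cond_exp_cong)
      show "AE \<omega> in M. a \<omega> * X i \<omega> = nn_cond_exp M H (\<lambda>\<omega>. a \<omega> * f i \<omega>) \<omega>"
        unfolding X_def by (rule H.nn_cond_exp_prod) measurable
    qed measurable
    ultimately show ?thesis by eventually_elim simp
  qed
  have "is_ess_sup M I (\<lambda>i. nn_cond_exp M G (\<lambda>\<omega>. a \<omega> * f i \<omega>)) (nn_cond_exp M G (\<lambda>\<omega>. a \<omega> * ?V \<omega>))"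
    unfolding is_ess_sup_def
  proof (intro conjI ballI impI)
    show "nn_cond_exp M G (\<lambda>\<omega>. a \<omega> * ?V \<omega>) \<in> borel_measurable M" by measurable
  next
    fix i assume i: "i \<in> I"
    have "AE \<omega> in M. X i \<omega> \<le> ?V \<omega>" using V i by (auto simp: is_ess_sup_def)
    then have "AE \<omega> in M. a \<omega> * X i \<omega> \<le> a \<omega> * ?V \<omega>" by eventually_elim (rule mult_left_mono, auto)
    then have "AE \<omega> in M. nn_cond_exp M G (\<lambda>\<omega>. a \<omega> * X i \<omega>) \<omega> \<le> nn_cond_exp M G (\<lambda>\<omega>. a \<omega> * ?V \<omega>) \<omega>"
      by (rule G.nn_cond_exp_mono) measurable
    with tower[OF i]
    show "AE \<omega> in M. nn_cond_exp M G (\<lambda>\<omega>. a \<omega> * f i \<omega>) \<omega> \<le> nn_cond_exp M G (\<lambda>\<omega>. a \<omega> * ?V \<omega>) \<omega>"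
      by eventually_elim simp
  next
    fix Z assume Z: "\<forall>i\<in>I. AE \<omega> in M. nn_cond_exp M G (\<lambda>\<omega>. a \<omega> * f i \<omega>) \<omega> \<le> Z \<omega>"
    have "AE \<omega> in M. nn_cond_exp M G (\<lambda>\<omega>. a \<omega> * ?V \<omega>) \<omega> = nn_cond_exp M G (\<lambda>\<omega>. SUP n. a \<omega> * X (s n) \<omega>) \<omega>"
      by (rule G.nn_cond_exp_cong)
        (use ess_sup_family_eq[OF s_sup] in \<open>auto elim!: eventually_mono simp: SUP_mult_left_ennreal\<close>)
    moreover have "AE \<omega> in M. (SUP n. nn_cond_exp M G (\<lambda>\<omega>. a \<omega> * X (s n) \<omega>) \<omega>) =
        nn_cond_exp M G (\<lambda>\<omega>. SUP n. a \<omega> * X (s n) \<omega>) \<omega>"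
    proof (rule G.nn_cond_exp_SUP)
      show "AE \<omega> in M. a \<omega> * X (s n) \<omega> \<le> a \<omega> * X (s (Suc n)) \<omega>" for n
        using s_inc[of n] by eventually_elim (rule mult_left_mono, auto)
    qed measurable
    moreover have "AE \<omega> in M. \<forall>n. nn_cond_exp M G (\<lambda>\<omega>. a \<omega> * X (s n) \<omega>) \<omega> \<le> Z \<omega>"
      unfolding AE_all_countable
    proof
      fix n
      show "AE \<omega> in M. nn_cond_exp M G (\<lambda>\<omega>. a \<omega> * X (s n) \<omega>) \<omega> \<le> Z \<omega>"
        using tower[OF s[of n]] Z[rule_format, OF s[of n]] by eventually_elim simp
    qed
    ultimately show "AE \<omega> in M. nn_cond_exp M G (\<lambda>\<omega>. a \<omega> * ?V \<omega>) \<omega> \<le> Z \<omega>"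
    proof eventually_elim
      case (elim \<omega>)
      have "(SUP n. nn_cond_exp M G (\<lambda>\<omega>. a \<omega> * X (s n) \<omega>) \<omega>) \<le> Z \<omega>"
        by (rule SUP_least) (use elim(3) in simp)
      then show ?case using elim(1,2) by simp
    qed
  qed
  then have "AE \<omega> in M. ess_sup_family M I (\<lambda>i. nn_cond_exp M G (\<lambda>\<omega>. a \<omega> * f i \<omega>)) \<omega> =
      nn_cond_exp M G (\<lambda>\<omega>. a \<omega> * ?V \<omega>) \<omega>"
    by (rule ess_sup_family_eq)
  then show ?thesis unfolding X_def by eventually_elim simp
qed

section \<open>Predictable times and strict pasts\<close>

context stochastic_basis
begin

lemma sets_F_subset_M: "t \<le> T \<Longrightarrow> sets (F t) \<subseteq> sets M"
  using sets_F_mono[of t T] sets_F_le by blast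

lemma sets_F_space: "A \<in> sets (F t) \<Longrightarrow> A \<subseteq> space M"
  using sets.sets_into_space[of A "F t"] by (simp add: space_F)

lemma
  shows space_predictable_sigma: "space (predictable_sigma M F T) = {0..T} \<times> space M"
    and sets_predictable_sigma: "sets (predictable_sigma M F T) = sigma_sets ({0..T} \<times> space M)
     ({{0} \<times> A | A. A \<in> sets (F 0)} \<union>
      {{s<..t} \<times> A | s t A. 0 \<le> s \<and> s < t \<and> t \<le> T \<and> A \<in> sets (F s)})"
proof -
  let ?G = "{{0} \<times> A | A. A \<in> sets (F 0)} \<union>
      {{s<..t} \<times> A | s t A. 0 \<le> s \<and> s < t \<and> t \<le> T \<and> A \<in> sets (F s)}"
  have "?G \<subseteq> Pow ({0..T} \<times> space M)"
    using horizon_pos by (auto dest: sets_F_space)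
  then show "space (predictable_sigma M F T) = {0..T} \<times> space M"
    "sets (predictable_sigma M F T) = sigma_sets ({0..T} \<times> space M) ?G"
    unfolding predictable_sigma_def by (simp_all add: space_measure_of sets_measure_of)
qed

lemma predictable_zero: "A \<in> sets (F 0) \<Longrightarrow> {0} \<times> A \<in> sets (predictable_sigma M F T)"
  unfolding sets_predictable_sigma by (rule sigma_sets.Basic) auto

lemma predictable_Ioc:
  assumes "0 \<le> s" "t \<le> T" "A \<in> sets (F s)"
  shows "{s<..t} \<times> A \<in> sets (predictable_sigma M F T)"
proof (cases "s < t")
  case True
  then show ?thesis
    unfolding sets_predictable_sigma using assms by (intro sigma_sets.Basic) auto
qed simp

lemma predictable_section:
  assumes "P \<in> sets (predictable_sigma M F T)" "t \<in> {0..T}"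
  shows "{\<omega>\<in>space M. (t, \<omega>) \<in> P} \<in> sets (F t)"
  using assms(1) unfolding sets_predictable_sigma
proof induction
  case (Basic P)
  then consider (zero) A where "A \<in> sets (F 0)" "P = {0} \<times> A"
    | (Ioc) s u A where "0 \<le> s" "s < u" "u \<le> T" "A \<in> sets (F s)" "P = {s<..u} \<times> A"
    by auto
  then show ?case
  proof cases
    case zero
    then have "{\<omega>\<in>space M. (t, \<omega>) \<in> P} = (if t = 0 then A else {})"
      using sets_F_space by auto
    then show ?thesis using zero by auto
  next
    case Ioc
    then have "{\<omega>\<in>space M. (t, \<omega>) \<in> P} = (if s < t \<and> t \<le> u then A else {})"
      using sets_F_space by auto
    then show ?thesis using Ioc sets_F_mono[of s t] by auto
  qed
next
  case Empty
  then show ?case by simp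
next
  case (Compl P)
  have "{\<omega>\<in>space M. (t, \<omega>) \<in> {0..T} \<times> space M - P} = space (F t) - {\<omega>\<in>space M. (t, \<omega>) \<in> P}"
    using assms(2) by (auto simp: space_F)
  then show ?case using Compl by auto
next
  case (Union P)
  have "{\<omega>\<in>space M. (t, \<omega>) \<in> (\<Union>i. P i)} = (\<Union>i. {\<omega>\<in>space M. (t, \<omega>) \<in> P i})" by auto
  then show ?case using Union by auto
qed

text \<open>
  Since the sections of predictable sets are adapted, a random time whose interval \<open>[[\<tau>, T]]\<close> is
  predictable is automatically a stopping time.
\<close>

lemma predictable_timesI:
  assumes range: "\<And>\<omega>. \<omega> \<in> space M \<Longrightarrow> \<tau> \<omega> \<in> {0..T}"
    and pred: "{(t, \<omega>). t \<in> {0..T} \<and> \<omega> \<in> space M \<and> \<tau> \<omega> \<le> t} \<in> sets (predictable_sigma M F T)"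
  shows "\<tau> \<in> predictable_times M F T"
proof -
  have "stopping_time F \<tau>"
  proof
    fix t
    consider "t < 0" | "t \<in> {0..T}" | "T < t" by fastforce
    then have "{\<omega>\<in>space (F t). \<tau> \<omega> \<le> t} \<in> sets (F t)"
    proof cases
      case 1
      then have eq: "{\<omega>\<in>space (F t). \<tau> \<omega> \<le> t} = {}" using range by (fastforce simp: space_F)
      show ?thesis unfolding eq by simp
    next
      case 2
      then show ?thesis using predictable_section[OF pred 2] by (simp add: space_F)
    next
      case 3
      then have eq: "{\<omega>\<in>space (F t). \<tau> \<omega> \<le> t} = space (F t)" using range by (fastforce simp: space_F)
      show ?thesis unfolding eq by simp
    qed
    then show "Measurable.pred (F t) (\<lambda>\<omega>. \<tau> \<omega> \<le> t)" by (simp add: pred_def)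
  qed
  then show ?thesis using assms by (auto simp: predictable_times_def)
qed

text \<open>
  The horizon belongs to every family of times considered here, which makes those families nonempty.
  It is announced by \<open>T - T / (n + 1)\<close>.
\<close>

lemma predictable_times_horizon: "(\<lambda>_. T) \<in> predictable_times M F T"
proof (rule predictable_timesI)
  define r where "r n = T - T / (real n + 1)" for n :: nat
  have r: "r n < T" for n using horizon_pos by (simp add: r_def)
  have approach: "\<exists>n. t \<le> r n" if "t < T" for t
  proof -
    obtain n :: nat where "T / (T - t) < real n"
      using reals_Archimedean2 by blast
    then have "T < real n * (T - t)" using that by (simp add: pos_divide_less_eq)
    also have "\<dots> \<le> (T - t) * (real n + 1)" using that by (simp add: algebra_simps)
    finally have "T / (real n + 1) < T - t" by (simp add: pos_divide_less_eq)
    then show ?thesis by (intro exI[of _ n]) (simp add: r_def)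
  qed
  have "{(t, \<omega>). t \<in> {0..T} \<and> \<omega> \<in> space M \<and> T \<le> t} =
      space (predictable_sigma M F T) - ({0} \<times> space M \<union> (\<Union>n. {0<..r n} \<times> space M))"
    (is "?L = ?R")
  proof
    show "?L \<subseteq> ?R"
      using r[unfolded not_le[symmetric]] horizon_pos by (auto simp: space_predictable_sigma)
    show "?R \<subseteq> ?L"
    proof
      fix p assume p: "p \<in> ?R"
      then obtain t \<omega> where "p = (t, \<omega>)" "0 \<le> t" "t \<le> T" "\<omega> \<in> space M"
        by (auto simp: space_predictable_sigma)
      moreover from this p have "t \<noteq> 0" "\<not> (\<exists>n. t \<le> r n)" by auto
      then have "T \<le> t" using approach[of t] by (auto simp: not_less[symmetric])
      ultimately show "p \<in> ?L" by auto
    qed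
  qed
  also have "?R \<in> sets (predictable_sigma M F T)"
  proof -
    have "space M \<in> sets (F 0)" using sets.top[of "F 0"] by (simp add: space_F)
    then have "{0} \<times> space M \<in> sets (predictable_sigma M F T)"
      "{0<..r n} \<times> space M \<in> sets (predictable_sigma M F T)" for n
      using r[of n] by (auto intro: predictable_zero predictable_Ioc)
    then show ?thesis by blast
  qed
  finally show "?L \<in> sets (predictable_sigma M F T)" .
qed (use horizon_pos in auto)

lemma
  shows space_strict_past[simp]: "space (strict_past M F T S) = space M"
    and sets_strict_past: "sets (strict_past M F T S) = sigma_sets (space M)
     (sets (F 0) \<union> {{\<omega> \<in> A. t < S \<omega>} | t A. t \<in> {0..T} \<and> A \<in> sets (F t)})"
proof -
  let ?G = "sets (F 0) \<union> {{\<omega> \<in> A. t < S \<omega>} | t A. t \<in> {0..T} \<and> A \<in> sets (F t)}"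
  have "?G \<subseteq> Pow (space M)" using sets_F_space by auto
  then show "space (strict_past M F T S) = space M"
    "sets (strict_past M F T S) = sigma_sets (space M) ?G"
    unfolding strict_past_def by (simp_all add: space_measure_of sets_measure_of)
qed

lemma sets_F_greater:
  assumes "stopping_time F S" "A \<in> sets (F t)"
  shows "{\<omega> \<in> A. t < S \<omega>} \<in> sets (F t)"
proof -
  have "{\<omega>\<in>space (F t). t < S \<omega>} \<in> sets (F t)"
    using stopping_timeD2[OF assms(1)] by (simp add: pred_def)
  then have "A \<inter> {\<omega>\<in>space (F t). t < S \<omega>} \<in> sets (F t)" using assms(2) by blast
  moreover have "A \<inter> {\<omega>\<in>space (F t). t < S \<omega>} = {\<omega> \<in> A. t < S \<omega>}"
    using sets.sets_into_space[OF assms(2)] by auto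
  ultimately show ?thesis by simp
qed

lemma subalgebra_strict_past:
  assumes "stopping_time F S"
  shows "subalgebra M (strict_past M F T S)"
  unfolding subalgebra_def sets_strict_past
proof (intro conjI sets.sigma_sets_subset)
  show "sets (F 0) \<union> {{\<omega> \<in> A. t < S \<omega>} | t A. t \<in> {0..T} \<and> A \<in> sets (F t)} \<subseteq> sets M"
  proof (intro Un_least subsetI)
    show "A \<in> sets M" if "A \<in> sets (F 0)" for A
      using that sets_F_subset_M[of 0] horizon_pos by auto
    show "B \<in> sets M" if "B \<in> {{\<omega> \<in> A. t < S \<omega>} | t A. t \<in> {0..T} \<and> A \<in> sets (F t)}" for B
    proof -
      from that obtain t A where "t \<in> {0..T}" "A \<in> sets (F t)" "B = {\<omega> \<in> A. t < S \<omega>}" by blast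
      then show ?thesis using sets_F_greater[OF assms] sets_F_subset_M[of t] by auto
    qed
  qed
qed simp

text \<open>
  The order of the times holds only almost surely, but a generator \<open>B = A \<inter> {t < S}\<close> differs from
  \<open>C = B \<inter> {t < \<theta>}\<close>, a generator of the larger sigma-field since \<open>B\<close> is in \<open>F t\<close>, by a null set, and
  completeness puts null sets into \<open>F 0\<close>.
\<close>

lemma strict_past_mono:
  assumes S: "stopping_time F S" and \<theta>: "stopping_time F \<theta>" and le: "AE \<omega> in M. S \<omega> \<le> \<theta> \<omega>"
  shows "subalgebra (strict_past M F T \<theta>) (strict_past M F T S)"
proof -
  let ?H = "strict_past M F T \<theta>"
  have F0: "sets (F 0) \<subseteq> sets ?H" unfolding sets_strict_past by auto
  have gen: "{\<omega> \<in> A. t < S \<omega>} \<in> sets ?H" if t: "t \<in> {0..T}" and A: "A \<in> sets (F t)" for t A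
  proof -
    define B where "B = {\<omega> \<in> A. t < S \<omega>}"
    define C where "C = {\<omega> \<in> B. t < \<theta> \<omega>}"
    have B: "B \<in> sets (F t)" unfolding B_def by (rule sets_F_greater[OF S A])
    have C: "C \<in> sets (F t)" unfolding C_def by (rule sets_F_greater[OF \<theta> B])
    have "C \<in> sets ?H"
      unfolding sets_strict_past C_def using t B by (intro sigma_sets.Basic) blast
    moreover have "B - C \<in> sets ?H"
    proof -
      have meas: "B - C \<in> sets M" using B C sets_F_subset_M[of t] t by auto
      have "AE \<omega> in M. \<omega> \<notin> B - C"
        using le by eventually_elim (auto simp: B_def C_def)
      then have "B - C \<in> null_sets M" using Measure_Space.AE_iff_null_sets[OF meas] by simp
      then show ?thesis using null_sets_F0 F0 by (meson subsetD)
    qed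
    ultimately have "C \<union> (B - C) \<in> sets ?H" by (rule sets.Un)
    moreover have "C \<union> (B - C) = B" by (auto simp: C_def)
    ultimately show ?thesis by (simp add: B_def)
  qed
  have "sets (strict_past M F T S) \<subseteq> sets ?H"
    unfolding sets_strict_past[of S] space_strict_past[of \<theta>, symmetric]
    using F0 gen by (intro sets.sigma_sets_subset) auto
  then show ?thesis by (simp add: subalgebra_def)
qed

text \<open>
  This is the predictability of \<open>[[\<theta>\<^sub>A, T]]\<close> for the restriction \<open>\<theta>\<^sub>A\<close> of \<open>\<theta>\<close> to an event \<open>A\<close> strictly
  before \<open>\<theta>\<close>. For a generator \<open>A = B \<inter> {t < \<theta>}\<close> the condition \<open>\<theta> \<le> u\<close> forces \<open>t < u\<close>, so the set is
  the trace on \<open>[[\<theta>, T]]\<close> of the predictable rectangle \<open>(t, T] \<times> A\<close>.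
\<close>

lemma predictable_restricted_interval:
  assumes \<theta>: "\<theta> \<in> predictable_times M F T" and A: "A \<in> sets (strict_past M F T \<theta>)"
  shows "{(t, \<omega>). t \<in> {0..T} \<and> \<omega> \<in> A \<and> \<theta> \<omega> \<le> t} \<in> sets (predictable_sigma M F T)"
proof -
  let ?P = "sets (predictable_sigma M F T)"
  let ?Z = "\<lambda>A. {(t, \<omega>). t \<in> {0..T} \<and> \<omega> \<in> A \<and> \<theta> \<omega> \<le> t}"
  have \<theta>P: "?Z (space M) \<in> ?P" and st: "stopping_time F \<theta>"
    using \<theta> by (auto simp: predictable_times_def)
  show ?thesis using A unfolding sets_strict_past
  proof induction
    case (Basic A)
    then consider (zero) "A \<in> sets (F 0)"
      | (greater) t B where "t \<in> {0..T}" "B \<in> sets (F t)" "A = {\<omega> \<in> B. t < \<theta> \<omega>}" by auto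
    then show ?case
    proof cases
      case zero
      then have "?Z A = ?Z (space M) \<inter> ({0} \<times> A \<union> {0<..T} \<times> A)"
        using sets_F_space[OF zero] by auto
      then show ?thesis
        using \<theta>P predictable_zero[OF zero] predictable_Ioc[OF order_refl order_refl zero] by auto
    next
      case greater
      have "?Z A = ?Z (space M) \<inter> ({t<..T} \<times> A)"
        using greater sets_F_space[OF greater(2)] by auto
      moreover have "A \<in> sets (F t)" using greater sets_F_greater[OF st] by simp
      ultimately show ?thesis
        using \<theta>P predictable_Ioc[of t T A] greater(1) by auto
    qed
  next
    case Empty
    then show ?case by simp
  next
    case (Compl A)
    have "?Z (space M - A) = ?Z (space M) - ?Z A" by auto
    then show ?case using Compl \<theta>P by auto
  next
    case (Union A)
    have "?Z (\<Union>i. A i) = (\<Union>i. ?Z (A i))" by auto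
    then show ?case using Union by auto
  qed
qed

text \<open>
  The maximum with \<open>\<theta>\<close> changes nothing almost surely when \<open>\<sigma>\<close> and \<open>\<tau>\<close> are almost surely at least \<open>\<theta>\<close>. It
  is there because predictability is a condition on every path: only from \<open>\<theta>\<close> on is the event \<open>A\<close>
  available.
\<close>

lemma predictable_times_glue:
  assumes \<theta>: "\<theta> \<in> predictable_times M F T" and A: "A \<in> sets (strict_past M F T \<theta>)"
    and \<sigma>: "\<sigma> \<in> predictable_times M F T" and \<tau>: "\<tau> \<in> predictable_times M F T"
  shows "(\<lambda>\<omega>. max (\<theta> \<omega>) (if \<omega> \<in> A then \<sigma> \<omega> else \<tau> \<omega>)) \<in> predictable_times M F T"
    (is "?\<rho> \<in> _")
proof (rule predictable_timesI)
  let ?P = "sets (predictable_sigma M F T)"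
  let ?Z = "\<lambda>A. {(t, \<omega>). t \<in> {0..T} \<and> \<omega> \<in> A \<and> \<theta> \<omega> \<le> t}"
  let ?I = "\<lambda>\<tau>. {(t, \<omega>). t \<in> {0..T} \<and> \<omega> \<in> space M \<and> \<tau> \<omega> \<le> t}"
  have "A \<subseteq> space M" using sets.sets_into_space[OF A] by simp
  then have eq: "?I ?\<rho> = ?Z A \<inter> ?I \<sigma> \<union> ?Z (space M - A) \<inter> ?I \<tau>"
    by (auto split: if_splits)
  have "space M - A \<in> sets (strict_past M F T \<theta>)"
    using sets.compl_sets[OF A] by simp
  then have "?Z A \<in> ?P" "?Z (space M - A) \<in> ?P"
    using A by (blast intro: predictable_restricted_interval[OF \<theta>])+
  moreover have "?I \<sigma> \<in> ?P" "?I \<tau> \<in> ?P"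
    using \<sigma> \<tau> unfolding predictable_times_def by blast+
  ultimately show "?I ?\<rho> \<in> ?P"
    unfolding eq by (intro sets.Un sets.Int)
qed (use \<theta> \<sigma> \<tau> in \<open>auto simp: predictable_times_def max_def\<close>)

text \<open>
  The hypothesis \<open>closed\<close> covers both the times from \<open>\<theta>\<close> and the times strictly after \<open>\<theta>\<close>: each
  class is defined by an almost sure pointwise condition, which a time inherits when it agrees at each
  point with one of two members.
\<close>

lemma nn_cond_exp_ess_sup_predictable:
  assumes \<phi>: "admissible_family M F T \<phi>"
    and S: "S \<in> predictable_times M F T" and \<theta>: "\<theta> \<in> predictable_times_from M F T S"
    and a: "a \<in> borel_measurable (strict_past M F T \<theta>)"
    and "I \<noteq> {}" and I: "I \<subseteq> predictable_times_from M F T \<theta>"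
    and closed: "\<And>\<rho> \<sigma> \<tau>. \<rho> \<in> predictable_times M F T \<Longrightarrow> \<sigma> \<in> I \<Longrightarrow> \<tau> \<in> I \<Longrightarrow>
      AE \<omega> in M. \<rho> \<omega> = \<sigma> \<omega> \<or> \<rho> \<omega> = \<tau> \<omega> \<Longrightarrow> \<rho> \<in> I"
  shows "AE \<omega> in M.
      nn_cond_exp M (strict_past M F T S) (\<lambda>\<omega>'. a \<omega>' *
        ess_sup_family M I (\<lambda>\<tau>. nn_cond_exp M (strict_past M F T \<theta>) (\<phi> \<tau>)) \<omega>') \<omega> =
      ess_sup_family M I
        (\<lambda>\<tau>. nn_cond_exp M (strict_past M F T S) (\<lambda>\<omega>'. a \<omega>' * \<phi> \<tau> \<omega>')) \<omega>"
proof -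
  have \<theta>p: "\<theta> \<in> predictable_times M F T" and S\<theta>: "AE \<omega> in M. S \<omega> \<le> \<theta> \<omega>"
    using \<theta> by (auto simp: predictable_times_from_def)
  have st: "stopping_time F \<tau>" if "\<tau> \<in> predictable_times M F T" for \<tau>
    using that by (simp add: predictable_times_def)
  have Ip: "\<tau> \<in> predictable_times M F T" "AE \<omega> in M. \<theta> \<omega> \<le> \<tau> \<omega>" if "\<tau> \<in> I" for \<tau>
    using that I by (auto simp: predictable_times_from_def)
  show ?thesis
  proof (rule nn_cond_exp_ess_sup[OF _ _ \<open>I \<noteq> {}\<close> _ _ a])
    show "subalgebra M (strict_past M F T \<theta>)"
      by (rule subalgebra_strict_past[OF st[OF \<theta>p]])
    show "subalgebra (strict_past M F T \<theta>) (strict_past M F T S)"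
      by (rule strict_past_mono[OF st[OF S] st[OF \<theta>p] S\<theta>])
    show "\<phi> \<tau> \<in> borel_measurable M" if "\<tau> \<in> I" for \<tau>
    proof (rule measurable_from_subalg)
      show "subalgebra M (strict_past M F T \<tau>)"
        by (rule subalgebra_strict_past[OF st[OF Ip(1)[OF that]]])
      show "\<phi> \<tau> \<in> borel_measurable (strict_past M F T \<tau>)"
        using \<phi> Ip(1)[OF that] by (simp add: admissible_family_def)
    qed
  next
    fix \<sigma> \<tau> A assume \<sigma>: "\<sigma> \<in> I" and \<tau>: "\<tau> \<in> I" and A: "A \<in> sets (strict_past M F T \<theta>)"
    define \<rho> where "\<rho> \<omega> = max (\<theta> \<omega>) (if \<omega> \<in> A then \<sigma> \<omega> else \<tau> \<omega>)" for \<omega>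
    have \<rho>p: "\<rho> \<in> predictable_times M F T"
      unfolding \<rho>_def using predictable_times_glue[OF \<theta>p A Ip(1)[OF \<sigma>] Ip(1)[OF \<tau>]] .
    have \<rho>_eq: "AE \<omega> in M. \<rho> \<omega> = (if \<omega> \<in> A then \<sigma> \<omega> else \<tau> \<omega>)"
      using Ip(2)[OF \<sigma>] Ip(2)[OF \<tau>] by eventually_elim (auto simp: \<rho>_def)
    then have "AE \<omega> in M. \<rho> \<omega> = \<sigma> \<omega> \<or> \<rho> \<omega> = \<tau> \<omega>" by eventually_elim auto
    then have "\<rho> \<in> I" by (rule closed[OF \<rho>p \<sigma> \<tau>])
    have "AE \<omega> in M. \<rho> \<omega> = \<sigma> \<omega> \<longrightarrow> \<phi> \<rho> \<omega> = \<phi> \<sigma> \<omega>" "AE \<omega> in M. \<rho> \<omega> = \<tau> \<omega> \<longrightarrow> \<phi> \<rho> \<omega> = \<phi> \<tau> \<omega>"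
      using \<phi> \<rho>p Ip(1)[OF \<sigma>] Ip(1)[OF \<tau>] by (auto simp: admissible_family_def)
    with \<rho>_eq have "AE \<omega> in M. (\<omega> \<in> A \<longrightarrow> \<phi> \<rho> \<omega> = \<phi> \<sigma> \<omega>) \<and> (\<omega> \<notin> A \<longrightarrow> \<phi> \<rho> \<omega> = \<phi> \<tau> \<omega>)"
      by eventually_elim auto
    with \<open>\<rho> \<in> I\<close> show "\<exists>\<rho>\<in>I. AE \<omega> in M. (\<omega> \<in> A \<longrightarrow> \<phi> \<rho> \<omega> = \<phi> \<sigma> \<omega>) \<and> (\<omega> \<notin> A \<longrightarrow> \<phi> \<rho> \<omega> = \<phi> \<tau> \<omega>)"
      by blast
  qed
qed

end

theorem mainTheorem1:
  fixes M :: "'a measure" and F :: "real \<Rightarrow> 'a measure" and T :: real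
    and \<phi> :: "('a \<Rightarrow> real) \<Rightarrow> 'a \<Rightarrow> ennreal"
    and S \<theta> :: "'a \<Rightarrow> real" and \<alpha> :: "'a \<Rightarrow> real"
  assumes "stochastic_basis M F T"
    and "admissible_family M F T \<phi>"
    and "S \<in> predictable_times M F T"
    and "\<theta> \<in> predictable_times_from M F T S"
    and "\<alpha> \<in> borel_measurable (strict_past M F T \<theta>)"
    and "\<forall>\<omega>\<in>space M. 0 \<le> \<alpha> \<omega>"
    and "bounded (\<alpha> ` space M)"
  shows "(AE \<omega> in M.
      nn_cond_exp M (strict_past M F T S) (\<lambda>\<omega>'. ennreal (\<alpha> \<omega>') * value_family M F T \<phi> \<theta> \<omega>') \<omega> =
      ess_sup_family M (predictable_times_from M F T \<theta>)
        (\<lambda>\<tau>. nn_cond_exp M (strict_past M F T S) (\<lambda>\<omega>'. ennreal (\<alpha> \<omega>') * \<phi> \<tau> \<omega>')) \<omega>)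
    \<and> (AE \<omega> in M.
      nn_cond_exp M (strict_past M F T S) (\<lambda>\<omega>'. ennreal (\<alpha> \<omega>') * strict_value_family M F T \<phi> \<theta> \<omega>') \<omega> =
      ess_sup_family M (predictable_times_after M F T \<theta>)
        (\<lambda>\<tau>. nn_cond_exp M (strict_past M F T S) (\<lambda>\<omega>'. ennreal (\<alpha> \<omega>') * \<phi> \<tau> \<omega>')) \<omega>)"
proof -
  interpret stochastic_basis M F T by fact
  have \<theta>: "\<theta> \<omega> \<le> T" if "\<omega> \<in> space M" for \<omega>
    using assms(4) that by (auto simp: predictable_times_from_def predictable_times_def)
  have a: "(\<lambda>\<omega>. ennreal (\<alpha> \<omega>)) \<in> borel_measurable (strict_past M F T \<theta>)"
    using assms(5) by measurable
  note main = nn_cond_exp_ess_sup_predictable[OF assms(2,3,4) a]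
  show ?thesis
    unfolding value_family_def strict_value_family_def
  proof (intro conjI main)
    show "predictable_times_from M F T \<theta> \<noteq> {}" "predictable_times_after M F T \<theta> \<noteq> {}"
      using predictable_times_horizon AE_I2[of M "\<lambda>\<omega>. \<theta> \<omega> \<le> T"] \<theta>
      by (auto simp: predictable_times_from_def predictable_times_after_def)
    show "predictable_times_after M F T \<theta> \<subseteq> predictable_times_from M F T \<theta>"
    proof
      fix \<tau> assume \<tau>: "\<tau> \<in> predictable_times_after M F T \<theta>"
      then have "AE \<omega> in M. (\<theta> \<omega> < T \<longrightarrow> \<theta> \<omega> < \<tau> \<omega>) \<and> (\<theta> \<omega> = T \<longrightarrow> \<tau> \<omega> = T)"
        by (simp add: predictable_times_after_def)
      then have "AE \<omega> in M. \<theta> \<omega> \<le> \<tau> \<omega>"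
        using AE_space by eventually_elim (use \<theta> in force)
      then show "\<tau> \<in> predictable_times_from M F T \<theta>"
        using \<tau> by (simp add: predictable_times_from_def predictable_times_after_def)
    qed
  next
    fix \<rho> \<sigma> \<tau>
    assume \<rho>: "\<rho> \<in> predictable_times M F T" and eq: "AE \<omega> in M. \<rho> \<omega> = \<sigma> \<omega> \<or> \<rho> \<omega> = \<tau> \<omega>"
    {
      assume "\<sigma> \<in> predictable_times_from M F T \<theta>" "\<tau> \<in> predictable_times_from M F T \<theta>"
      then have "AE \<omega> in M. \<theta> \<omega> \<le> \<sigma> \<omega>" "AE \<omega> in M. \<theta> \<omega> \<le> \<tau> \<omega>"
        by (auto simp: predictable_times_from_def)
      with eq have "AE \<omega> in M. \<theta> \<omega> \<le> \<rho> \<omega>" by eventually_elim auto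
      with \<rho> show "\<rho> \<in> predictable_times_from M F T \<theta>" by (simp add: predictable_times_from_def)
    next
      assume "\<sigma> \<in> predictable_times_after M F T \<theta>" "\<tau> \<in> predictable_times_after M F T \<theta>"
      then have "AE \<omega> in M. (\<theta> \<omega> < T \<longrightarrow> \<theta> \<omega> < \<sigma> \<omega>) \<and> (\<theta> \<omega> = T \<longrightarrow> \<sigma> \<omega> = T)"
        "AE \<omega> in M. (\<theta> \<omega> < T \<longrightarrow> \<theta> \<omega> < \<tau> \<omega>) \<and> (\<theta> \<omega> = T \<longrightarrow> \<tau> \<omega> = T)"
        by (auto simp: predictable_times_after_def)
      with eq have "AE \<omega> in M. (\<theta> \<omega> < T \<longrightarrow> \<theta> \<omega> < \<rho> \<omega>) \<and> (\<theta> \<omega> = T \<longrightarrow> \<rho> \<omega> = T)"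
        by eventually_elim auto
      with \<rho> show "\<rho> \<in> predictable_times_after M F T \<theta>" by (simp add: predictable_times_after_def)
    }
  qed simp
qed

end
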